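(* Let $p\ge 1$ be an integer and let $F:\mathbb{R}^d\to\mathbb{R}^d$. Suppose there is a point $z^*\in\mathcal{Z}^*$ and a parameter $0\le\rho<2$ such that $$\langle F(z),z-z^*\rangle\ \ge\ -\frac{\rho}{2}\,\|F(z)\|^{\frac{p+1}{p}}\qquad\text{for all } z\in\mathbb{R}^d .$$ Let $z_0\in\mathbb{R}^d$ and let $(s,v,z)$ be a solution on $[0,\infty)$, with $s(0)=0$, of the system $$\dot s(t)=-\frac{F(z(t))}{\|F(z(t))\|^{1-1/p}},\qquad v(t)=z_0+s(t),\qquad z(t)-v(t)+\frac{F(z(t))}{\|F(z(t))\|^{1-1/p}}=0 .$$ Then $$\min_{0\le s\le t}\|F(z(s))\|^2=O\!\left(\frac{1}{t^{p}}\right),$$ i.e. there is a constant $C$ independent of $t$ such that $\min_{0\le s\le t}\|F(z(s))\|^2\le C/t^p$ for all $t>0$.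
   Context: $\|\cdot\|$ and $\langle\cdot,\cdot\rangle$ are the Euclidean norm and inner product on $\mathbb{R}^d$. The setting is unconstrained: $\mathcal{Z}=\mathbb{R}^d$. $\mathcal{Z}^*$ is the set of solutions of the Stampacchia variational inequality, i.e. points $z^*\in\mathbb{R}^d$ with $\langle F(z^* ),z-z^*\rangle\ge 0$ for all $z\in\mathbb{R}^d$; in this unconstrained setting these are exactly the points with $F(z^* )=0$. A solution of the system means functions $s,v,z:[0,\infty)\to\mathbb{R}^d$ with $s$ continuously differentiable and $z$ continuous, satisfying the three relations for all $t\ge 0$; the quotient $F/\|F\|^{1-1/p}$ is read as $0$ where $F=0$. *)

theory Defs
  imports "HOL-Analysis.Analysis"
begin

definition stampacchia_solutions ::
  "(real ^ 'd) set \<Rightarrow> (real ^ 'd \<Rightarrow> real ^ 'd) \<Rightarrow> (real ^ 'd) set" where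
  "stampacchia_solutions Z F = {zs \<in> Z. \<forall>z\<in>Z. F zs \<bullet> (z - zs) \<ge> 0}"

text \<open>
  The quotient of \<open>w\<close> by the power \<open>1 - 1/p\<close> of its norm. Its value is \<open>0\<close> at \<open>w = 0\<close>,
  for every \<open>p\<close>. Note that \<open>0 powr 0 = 0\<close>, so for \<open>p = 1\<close> the denominator is \<open>1\<close> only
  if \<open>w \<noteq> 0\<close>; this does not matter, since the numerator vanishes as well.
\<close>
definition normalized :: "nat \<Rightarrow> real ^ 'd \<Rightarrow> real ^ 'd" where
  "normalized p w = w /\<^sub>R (norm w powr (1 - 1 / real p))"

text \<open>
  Solutions on \<open>[0,\<infinity>)\<close>: only values at times \<open>t \<ge> 0\<close> matter. The function \<open>s'\<close> is the
  continuous derivative of \<open>s\<close> on the half-line, one-sided at \<open>t = 0\<close>.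
\<close>
definition is_solution ::
  "nat \<Rightarrow> (real ^ 'd \<Rightarrow> real ^ 'd) \<Rightarrow> real ^ 'd \<Rightarrow>
    (real \<Rightarrow> real ^ 'd) \<Rightarrow> (real \<Rightarrow> real ^ 'd) \<Rightarrow> (real \<Rightarrow> real ^ 'd) \<Rightarrow> bool" where
  "is_solution p F z0 s v z \<longleftrightarrow>
    continuous_on {0..} z \<and>
    (\<exists>s'. continuous_on {0..} s' \<and>
      (\<forall>t\<ge>0. (s has_vector_derivative s' t) (at t within {0..}) \<and>
             s' t = - normalized p (F (z t)))) \<and>
    (\<forall>t\<ge>0. v t = z0 + s t) \<and>
    (\<forall>t\<ge>0. z t - v t + normalized p (F (z t)) = 0)"

end

theory Submission imports Defs begin

text \<open>
  Write \<open>N\<close> for the normalized field along the solution, so that \<open>v' = - N\<close>, \<open>z = v - N\<close> and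
  \<open>\<parallel>F(z)\<parallel> = \<parallel>N\<parallel>\<^sup>p\<close>. Dividing the hypothesis on \<open>F\<close> by \<open>\<parallel>F(z)\<parallel> powr (1 - 1/p)\<close> turns it into
  \<open>\<langle>N, z - z\<^sup>*\<rangle> \<ge> - (\<rho>/2) \<parallel>N\<parallel>\<^sup>2\<close>, so \<open>E = \<parallel>v - z\<^sup>*\<parallel>\<^sup>2\<close> satisfies \<open>E' \<le> - (2 - \<rho>) \<parallel>N\<parallel>\<^sup>2\<close>. Hence
  \<open>(2 - \<rho>) t min \<parallel>N\<parallel>\<^sup>2 \<le> E(0)\<close>, and the claim is the \<open>p\<close>-th power of this bound.
\<close>

lemma norm_normalized:
  "norm (normalized p w) = norm w powr (1 / real p)"
proof (cases "w = 0")
  case True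
  then show ?thesis by (simp add: normalized_def)
next
  case False
  have "norm (normalized p w) = norm w powr 1 / norm w powr (1 - 1 / real p)"
    using False by (simp add: normalized_def field_simps)
  also have "\<dots> = norm w powr (1 / real p)"
    using powr_diff[of "norm w" 1 "1 - 1 / real p"] by simp
  finally show ?thesis .
qed

text \<open>The exponents \<open>1 / p\<close> and \<open>p\<close> cancel. At \<open>w = 0\<close>
  the assumption \<open>p \<ge> 1\<close> excludes \<open>0 ^ 0 = 1\<close>.\<close>

lemma norm_normalized_power:
  assumes "p \<ge> 1"
  shows "norm (normalized p w) ^ p = norm w"
proof (cases "w = 0")
  case True
  then show ?thesis using assms by (simp add: normalized_def)
next
  case False
  then have "norm (normalized p w) ^ p = norm w powr (1 / real p * real p)"
    by (simp add: norm_normalized powr_powr flip: powr_realpow)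
  then show ?thesis using assms by simp
qed

text \<open>The exponent \<open>(p + 1) / p\<close> splits as \<open>(1 - 1 / p) + 2 / p\<close>:
  the first summand is the divisor in \<open>normalized\<close>, the second gives the squared norm
  of the quotient.\<close>

lemma normalized_inner_ge:
  assumes "p \<ge> 1"
    and w: "w \<bullet> y \<ge> - c * norm w powr ((real p + 1) / real p)"
  shows "normalized p w \<bullet> y \<ge> - c * (norm (normalized p w))\<^sup>2"
proof (cases "w = 0")
  case True
  then show ?thesis by (simp add: normalized_def)
next
  case False
  define q where "q = norm w powr (1 - 1 / real p)"
  have q: "q > 0" using False by (simp add: q_def)
  have "q * (norm (normalized p w))\<^sup>2 = norm w powr (1 - 1 / real p + (1 / real p + 1 / real p))"
    by (simp only: q_def norm_normalized power2_eq_square powr_add)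
  also have "1 - 1 / real p + (1 / real p + 1 / real p) = (real p + 1) / real p"
    using assms(1) by (simp add: field_simps)
  finally have "- c * (q * (norm (normalized p w))\<^sup>2) \<le> w \<bullet> y" using w by simp
  also have "w \<bullet> y = q * (normalized p w \<bullet> y)"
    using q by (simp add: normalized_def q_def)
  finally have "q * (- c * (norm (normalized p w))\<^sup>2) \<le> q * (normalized p w \<bullet> y)"
    by (simp add: algebra_simps)
  then show ?thesis using q by (simp only: mult_le_cancel_left_pos)
qed

theorem theorem3p1:
  fixes p :: nat
    and F :: "real ^ 'd \<Rightarrow> real ^ 'd"
    and zstar z0 :: "real ^ 'd"
    and \<rho> :: real
    and s v z :: "real \<Rightarrow> real ^ 'd"
  assumes "p \<ge> 1"
    and "zstar \<in> stampacchia_solutions UNIV F"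
    and "0 \<le> \<rho>" and "\<rho> < 2"
    and "\<And>x. F x \<bullet> (x - zstar) \<ge> - (\<rho> / 2) * norm (F x) powr ((real p + 1) / real p)"
    and "is_solution p F z0 s v z"
    and "s 0 = 0"
  shows "\<exists>C::real. \<forall>t>0. \<exists>\<sigma>.
           is_arg_min (\<lambda>\<tau>. (norm (F (z \<tau>)))\<^sup>2) (\<lambda>\<tau>. \<tau> \<in> {0..t}) \<sigma> \<and>
           (norm (F (z \<sigma>)))\<^sup>2 \<le> C / t ^ p"
proof -
  define N where "N t = normalized p (F (z t))" for t
  define E where "E t = (norm (v t - zstar))\<^sup>2" for t
  \<comment> \<open>Since \<open>s 0 = 0\<close>, \<open>E 0\<close> is the squared distance from
    \<open>z0\<close> to \<open>zstar\<close>.\<close>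
  define C where "C = (E 0 / (2 - \<rho>)) ^ p"
  from assms(6) obtain s' where
    cz: "continuous_on {0..} z" and
    s': "\<And>t. t \<ge> 0 \<Longrightarrow> (s has_vector_derivative s' t) (at t within {0..})"
        "\<And>t. t \<ge> 0 \<Longrightarrow> s' t = - N t" and
    v: "\<And>t. t \<ge> 0 \<Longrightarrow> v t = z0 + s t" and
    zv: "\<And>t. t \<ge> 0 \<Longrightarrow> z t - v t + N t = 0"
    unfolding is_solution_def N_def by blast
  have dv: "(v has_vector_derivative - N t) (at t within {0..})" if "t \<ge> 0" for t
  proof -
    have "((\<lambda>t. z0 + s t) has_vector_derivative 0 + - N t) (at t within {0..})"
      using s'[OF that] by (intro derivative_intros) simp
    then show ?thesis
      using that v by (auto intro: has_vector_derivative_transform)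
  qed
  \<comment> \<open>\<open>F\<close> is not assumed continuous, so continuity of \<open>N\<close> is
    read off from \<open>N = v - z\<close>.\<close>
  have "continuous_on {0..} v"
    using dv has_vector_derivative_continuous
    by (fastforce simp: continuous_on_eq_continuous_within)
  then have "continuous_on {0..} (\<lambda>t. v t - z t)" using cz by (intro continuous_intros)
  moreover have N_eq: "N t = v t - z t" if "t \<ge> 0" for t
    using zv[OF that] by (simp add: algebra_simps add_eq_0_iff2)
  ultimately have "continuous_on {0..} N"
    by (subst continuous_on_cong[OF refl N_eq]) auto
  then have cN: "continuous_on {0..t} (\<lambda>\<tau>. (norm (N \<tau>))\<^sup>2)" for t
    by (intro continuous_intros) (auto elim: continuous_on_subset)
  have dE: "(E has_derivative (\<lambda>h. h * (- 2 * (N t \<bullet> (v t - zstar))))) (at t within {0..})"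
    if "t \<ge> 0" for t
    using dv[OF that] unfolding has_vector_derivative_def E_def power2_norm_eq_inner
    by (auto intro!: derivative_eq_intros simp: inner_commute algebra_simps)
  \<comment> \<open>Passing from \<open>z\<close> to \<open>v = z + N\<close> adds a full squared
    norm of \<open>N\<close>, which makes the coefficient \<open>1 - \<rho> / 2\<close>
    positive.\<close>
  have N_inner: "N t \<bullet> (v t - zstar) \<ge> (1 - \<rho> / 2) * (norm (N t))\<^sup>2" if "t \<ge> 0" for t
  proof -
    have "N t \<bullet> (z t - zstar) \<ge> - (\<rho> / 2) * (norm (N t))\<^sup>2"
      unfolding N_def by (rule normalized_inner_ge[OF assms(1) assms(5)])
    moreover have "v t - zstar = N t + (z t - zstar)" using N_eq[OF that] by simp
    ultimately show ?thesis
      by (simp add: inner_add_right power2_norm_eq_inner algebra_simps)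
  qed
  have normF: "(norm (F (z t)))\<^sup>2 = ((norm (N t))\<^sup>2) ^ p" for t
    using norm_normalized_power[OF assms(1), of "F (z t)"]
    unfolding N_def by (metis power_mult mult.commute)
  show ?thesis
  proof (rule exI[of _ C], intro allI impI)
    fix t :: real assume t: "t > 0"
    \<comment> \<open>A minimizer for \<open>N\<close> also serves for \<open>F\<close>: by
      \<open>normF\<close> the two quantities differ by a monotone \<open>p\<close>-th
      power.\<close>
    obtain \<sigma> where \<sigma>: "\<sigma> \<in> {0..t}"
      and min: "\<And>\<tau>. \<tau> \<in> {0..t} \<Longrightarrow> (norm (N \<sigma>))\<^sup>2 \<le> (norm (N \<tau>))\<^sup>2"
      using continuous_attains_inf[OF compact_Icc _ cN, of t] t
      by (metis atLeastatMost_empty_iff less_le_not_le)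
    have "(E has_derivative (\<lambda>h. h * (- 2 * (N \<tau> \<bullet> (v \<tau> - zstar))))) (at \<tau> within {0..t})"
      if "0 \<le> \<tau>" for \<tau>
      using dE[OF that] by (rule has_derivative_subset) auto
    \<comment> \<open>The mean value theorem replaces integrating \<open>E'\<close>: one
      intermediate time \<open>x\<close> suffices, because the minimum at \<open>\<sigma>\<close>
      lies below the value at \<open>x\<close>.\<close>
    then obtain x where x: "x \<in> {0<..<t}"
      and mvt: "E t - E 0 = (t - 0) * (- 2 * (N x \<bullet> (v x - zstar)))"
      using mvt_simple[OF t, of E "\<lambda>\<tau> h. h * (- 2 * (N \<tau> \<bullet> (v \<tau> - zstar)))"]
      by metis
    have "(1 - \<rho> / 2) * (norm (N \<sigma>))\<^sup>2 \<le> (1 - \<rho> / 2) * (norm (N x))\<^sup>2"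
      using min x assms(4) by (intro mult_left_mono) auto
    also have "\<dots> \<le> N x \<bullet> (v x - zstar)" using N_inner x by simp
    finally have "t * ((2 - \<rho>) * (norm (N \<sigma>))\<^sup>2) \<le> t * (2 * (N x \<bullet> (v x - zstar)))"
      using t by (intro mult_left_mono) (auto simp: algebra_simps)
    also have "\<dots> = E 0 - E t" using mvt by simp
    also have "\<dots> \<le> E 0" by (simp add: E_def)
    finally have "(norm (N \<sigma>))\<^sup>2 \<le> E 0 / (2 - \<rho>) / t"
      using t assms(4) by (simp add: field_simps)
    then have "((norm (N \<sigma>))\<^sup>2) ^ p \<le> (E 0 / (2 - \<rho>) / t) ^ p"
      by (intro power_mono) auto
    then have "(norm (F (z \<sigma>)))\<^sup>2 \<le> C / t ^ p"
      by (simp only: normF C_def power_divide)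
    moreover have "(norm (F (z \<sigma>)))\<^sup>2 \<le> (norm (F (z \<tau>)))\<^sup>2" if "\<tau> \<in> {0..t}" for \<tau>
      unfolding normF by (rule power_mono[OF min[OF that]]) simp
    ultimately show "\<exists>\<sigma>. is_arg_min (\<lambda>\<tau>. (norm (F (z \<tau>)))\<^sup>2) (\<lambda>\<tau>. \<tau> \<in> {0..t}) \<sigma> \<and>
        (norm (F (z \<sigma>)))\<^sup>2 \<le> C / t ^ p"
      using \<sigma> by (auto simp: is_arg_min_linorder)
  qed
qed

end
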